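(* Let $G=(S,T;E)$ with $S=\{s_1,\dots,s_n\}$ and let $d\in\{1,2\}$. Then the polyhedra defined by the constraints of (LP1) and of (LP2) are integral (every vertex is an integer vector).
   Context: $G$ is a finite bipartite graph without loops or parallel edges; the nodes of $S$ are in the fixed order $s_1,\dots,s_n$. $\Delta(v)$ is the set of edges incident to $v$, and $R_d(s_i)=\{s_i,\dots,s_{\min(i+d-1,n)}\}$. (LP1) has feasible region $x\in\mathbb R_+^E$, $\sum_{st\in\Delta(s)}x_{st}\le 1$ for all $s\in S$, $\sum_{s't\in E:\,s'\in R_d(s)}x_{s't}\le1$ for all $s\in S,t\in T$ (with objective maximize $\sum_{st\in E}w_{st}x_{st}$ for $w:E\to\mathbb R_+$). (LP2) is the same program with the constraints $\sum_{st\in\Delta(s)}x_{st}\le1$ replaced by $\sum_{st\in\Delta(s)}x_{st}=1$ for all $s\in S$. *)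

theory Defs
  imports "HOL-Analysis.Analysis"
begin

text \<open>
  A bipartite graph has colour classes \<open>S :: 's set\<close> and \<open>T :: 't set\<close> and edge set
  \<open>E \<subseteq> S \<times> T\<close>, an edge \<open>st\<close> being the pair \<open>(s, t)\<close>. The classes are disjoint because they
  live in different types, and loops and parallel edges cannot occur.

  The fixed order \<open>s\<^sub>1, \<dots>, s\<^sub>n\<close> of \<open>S\<close> is a function \<open>s :: nat \<Rightarrow> 's\<close> restricting to a bijection
  from \<open>{1..n}\<close> onto \<open>S\<close>.
\<close>

definition incident_edges :: "('s \<times> 't) set \<Rightarrow> 's \<Rightarrow> ('s \<times> 't) set" where
  "incident_edges E v = {e \<in> E. fst e = v}"

definition window :: "(nat \<Rightarrow> 's) \<Rightarrow> nat \<Rightarrow> nat \<Rightarrow> nat \<Rightarrow> 's set" where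
  "window s n d i = s ` {i..min (i + d - 1) n}"

text \<open>
  The space of real vectors indexed by \<open>E\<close> is the coordinate subspace of \<open>real ^ ('s \<times> 't)\<close>
  of the vectors that vanish outside \<open>E\<close>; \<open>E\<close> itself may be any set of pairs, even empty.
\<close>

definition nonneg_vectors :: "('s::finite \<times> 't::finite) set \<Rightarrow> (real ^ ('s \<times> 't)) set" where
  "nonneg_vectors E = {x. (\<forall>e\<in>E. 0 \<le> x $ e) \<and> (\<forall>e. e \<notin> E \<longrightarrow> x $ e = 0)}"

definition LP1_region ::
  "(nat \<Rightarrow> 's::finite) \<Rightarrow> nat \<Rightarrow> 't::finite set \<Rightarrow> ('s \<times> 't) set \<Rightarrow> nat \<Rightarrow> (real ^ ('s \<times> 't)) set"
  where
  "LP1_region s n T E d = {x \<in> nonneg_vectors E.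
     (\<forall>i\<in>{1..n}. (\<Sum>e\<in>incident_edges E (s i). x $ e) \<le> 1) \<and>
     (\<forall>i\<in>{1..n}. \<forall>t\<in>T. (\<Sum>e\<in>{(s', t'). (s', t') \<in> E \<and> s' \<in> window s n d i \<and> t' = t}. x $ e) \<le> 1)}"

definition LP2_region ::
  "(nat \<Rightarrow> 's::finite) \<Rightarrow> nat \<Rightarrow> 't::finite set \<Rightarrow> ('s \<times> 't) set \<Rightarrow> nat \<Rightarrow> (real ^ ('s \<times> 't)) set"
  where
  "LP2_region s n T E d = {x \<in> nonneg_vectors E.
     (\<forall>i\<in>{1..n}. (\<Sum>e\<in>incident_edges E (s i). x $ e) = 1) \<and>
     (\<forall>i\<in>{1..n}. \<forall>t\<in>T. (\<Sum>e\<in>{(s', t'). (s', t') \<in> E \<and> s' \<in> window s n d i \<and> t' = t}. x $ e) \<le> 1)}"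

definition integral_polyhedron :: "(real ^ 'k) set \<Rightarrow> bool" where
  "integral_polyhedron P \<longleftrightarrow>
     polyhedron P \<and> (\<forall>x. x extreme_point_of P \<longrightarrow> (\<forall>k. x $ k \<in> \<int>))"

end

theory Submission
  imports Defs
begin

text \<open>
  Multiplying the entries of row \<open>i\<close> of \<open>x\<close>, together with its slacks, by \<open>(-1)\<^sup>i\<close> turns the
  constraints for \<open>d = 2\<close> into a network flow with integral demands. If \<open>x\<close> is fractional, no node
  meets exactly one fractional arc, so the fractional arcs carry a nonzero circulation. Undoing the
  signs gives a direction that preserves every tight constraint, hence \<open>x\<close> is not extreme. The case
  \<open>d = 1\<close> needs nothing more: its column constraints involve single entries, and the direction
  vanishes at integral entries.
\<close>

section \<open>Circulations on the fractional arcs of a flow\<close>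

text \<open>Outflow minus inflow at \<open>v\<close>, with tail \<open>p\<close> and head
  \<open>q\<close>. Arcs are mere labels, so the loops and parallel arcs created by contraction are
  harmless.\<close>

definition divergence :: "('a \<Rightarrow> 'v) \<Rightarrow> ('a \<Rightarrow> 'v) \<Rightarrow> 'a set \<Rightarrow> ('a \<Rightarrow> real) \<Rightarrow> 'v \<Rightarrow> real" where
  "divergence p q A f v = (\<Sum>a\<in>A. f a * (of_bool (p a = v) - of_bool (q a = v)))"

text \<open>By induction on the number of arcs. A loop alone carries a circulation. Contracting any
  other arc adds up the divergences at its ends, so they stay integral, and a circulation of the
  rest extends to that arc.\<close>

lemma fractional_flow_has_circulation_aux:
  assumes "finite A" "A \<noteq> {}" "\<And>a. a \<in> A \<Longrightarrow> f a \<notin> \<int>" "\<And>v. divergence p q A f v \<in> \<int>"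
  shows "\<exists>g. (\<exists>a\<in>A. g a \<noteq> 0) \<and> (\<forall>v. divergence p q A g v = 0)"
  using assms
proof (induction "card A" arbitrary: A p q)
  case 0
  then show ?case by simp
next
  case (Suc m)
  show ?case
  proof (cases "\<exists>a\<in>A. p a = q a")
    case True
    then obtain a where a: "a \<in> A" "p a = q a" by blast
    have "divergence p q A (\<lambda>b. of_bool (b = a)) v = 0" for v
      unfolding divergence_def using a(2) by (intro sum.neutral) auto
    with a(1) show ?thesis by (intro exI[of _ "\<lambda>b. of_bool (b = a)"]) auto
  next
    case False
    obtain a where a: "a \<in> A" using Suc.prems by blast
    define B where "B = A - {a}"
    txt \<open>Contract the arc \<open>a\<close>; its value is afterwards determined by conservation at \<open>p a\<close>.\<close>
    define c where "c v = (if v = q a then p a else v)" for v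
    have pq: "p a \<noteq> q a" using False a by blast
    have split: "divergence p q A g v = divergence p q B g v
        + g a * (of_bool (p a = v) - of_bool (q a = v))" for g v
      unfolding divergence_def B_def using Suc.prems(1) a by (simp add: sum.remove)
    have contract: "divergence (c \<circ> p) (c \<circ> q) B g v =
        (if v = q a then 0 else if v = p a then divergence p q B g (p a) + divergence p q B g (q a)
         else divergence p q B g v)" for g v
    proof -
      have "\<And>w. of_bool (c w = v) = (if v = q a then 0::real else if v = p a then
          of_bool (w = p a) + of_bool (w = q a) else of_bool (w = v))"
        using pq by (auto simp: c_def)
      then show ?thesis
        unfolding divergence_def by (auto simp: sum.distrib[symmetric] algebra_simps intro!: sum.cong)
    qed
    have B: "finite B" "card B = m" using Suc a by (auto simp: B_def)
    \<comment> \<open>If \<open>a\<close> were the only arc, the divergence at its tail would be the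
      fractional number \<open>f a\<close>.\<close>
    have "B \<noteq> {}"
    proof
      assume "B = {}"
      then have "divergence p q A f (p a) = f a"
        using split[of f "p a"] pq by (simp add: divergence_def)
      then show False using Suc.prems a by metis
    qed
    moreover have "divergence (c \<circ> p) (c \<circ> q) B f v \<in> \<int>" for v
    proof -
      have "divergence p q B f (p a) + divergence p q B f (q a) \<in> \<int>"
        using split[of f "p a"] split[of f "q a"] pq
          Ints_add[OF Suc.prems(4)[of "p a"] Suc.prems(4)[of "q a"]] by simp
      moreover have "divergence p q B f v \<in> \<int>" if "v \<noteq> p a" "v \<noteq> q a"
        using split[of f v] Suc.prems(4)[of v] that by auto
      ultimately show ?thesis by (simp add: contract)
    qed
    ultimately obtain g where g: "\<exists>b\<in>B. g b \<noteq> 0" "\<And>v. divergence (c \<circ> p) (c \<circ> q) B g v = 0"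
      using Suc.hyps(1)[of B "c \<circ> p" "c \<circ> q"] B Suc.prems(3) by (auto simp: B_def)
    define g' where "g' = g(a := - divergence p q B g (p a))"
    have same: "divergence p q B g' v = divergence p q B g v" for v
      unfolding divergence_def g'_def B_def by (intro sum.cong) auto
    have g'a: "g' a = - divergence p q B g (p a)" by (simp add: g'_def)
    \<comment> \<open>The value at \<open>a\<close> balances \<open>p a\<close>; then
      \<open>q a\<close> is balanced too, as the divergences over \<open>B\<close> at the two ends
      sum to zero.\<close>
    have "divergence p q A g' v = 0" for v
      using split[of g' v] g(2)[of v] g(2)[of "p a"] pq
      unfolding same contract g'a by (auto split: if_splits)
    moreover have "\<exists>b\<in>A. g' b \<noteq> 0" using g(1) by (auto simp: g'_def B_def)
    ultimately show ?thesis by blast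
  qed
qed

text \<open>Integral arcs add integers to each divergence, so the fractional arcs alone have
  integral divergence. Their circulation is extended by zero.\<close>

lemma fractional_flow_has_circulation:
  assumes "finite A" "\<exists>a\<in>A. f a \<notin> \<int>" "\<And>v. divergence p q A f v \<in> \<int>"
  shows "\<exists>g. (\<exists>a\<in>A. g a \<noteq> 0) \<and> (\<forall>a. a \<notin> A \<or> f a \<in> \<int> \<longrightarrow> g a = 0)
    \<and> (\<forall>v. divergence p q A g v = 0)"
proof -
  define F where "F = {a \<in> A. f a \<notin> \<int>}"
  have split: "divergence p q A h v = divergence p q (A - F) h v + divergence p q F h v" for h v
    unfolding divergence_def by (rule sum.subset_diff) (use assms(1) in \<open>auto simp: F_def\<close>)
  have "divergence p q (A - F) f v \<in> \<int>" for v
    unfolding divergence_def F_def by (intro Ints_sum Ints_mult Ints_diff) auto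
  then have "divergence p q F f v \<in> \<int>" for v
    using split[of f v] assms(3)[of v] Ints_diff by fastforce
  moreover have "finite F" "F \<noteq> {}" "\<And>a. a \<in> F \<Longrightarrow> f a \<notin> \<int>"
    using assms(1,2) by (auto simp: F_def)
  ultimately obtain g where g: "\<exists>a\<in>F. g a \<noteq> 0" "\<And>v. divergence p q F g v = 0"
    using fractional_flow_has_circulation_aux[of F f p q] by blast
  define g' where "g' a = (if a \<in> F then g a else 0)" for a
  have "divergence p q F g' v = divergence p q F g v" "divergence p q (A - F) g' v = 0" for v
    unfolding divergence_def g'_def by (auto intro!: sum.cong sum.neutral)
  then have "divergence p q A g' v = 0" for v using split[of g' v] g(2) by simp
  then show ?thesis using g(1) by (intro exI[of _ g']) (auto simp: g'_def F_def)
qed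

section \<open>The network of the sign-changed grid\<close>

text \<open>
  The node \<open>(i, Some t)\<close> stands for \<open>x\<^sub>i\<^sub>t + x\<^sub>i\<^sub>+\<^sub>1\<^sub>t + u\<^sub>i\<^sub>t = 1\<close>. With \<open>r\<^sub>i\<close> the slack of row \<open>i\<close>,
  the node \<open>(i, None)\<close> stands for the equation of row \<open>i\<close> plus that of row \<open>i + 1\<close> minus all the
  equations \<open>(i, Some t)\<close>, which leaves \<open>r\<^sub>i + r\<^sub>i\<^sub>+\<^sub>1 - (\<Sum>t. u\<^sub>i\<^sub>t)\<close> constant: the row slacks
  behave like an extra column \<open>None\<close>.
\<close>

definition grid_flow :: "(nat \<Rightarrow> 't option \<Rightarrow> real) \<Rightarrow> (nat \<Rightarrow> 't \<Rightarrow> real) \<Rightarrow>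
    nat \<times> 't option + nat \<times> 't \<Rightarrow> real" where
  "grid_flow z u = case_sum (\<lambda>(i, c). z (Suc i) c) (\<lambda>(i, t). u i t)"

text \<open>\<open>Inl (i, c)\<close> carries the entry of row \<open>i + 1\<close>, which occurs in
  the equations at \<open>i\<close> and \<open>i + 1\<close>. So entries need \<open>n\<close> rows
  of arcs, while slacks start at row \<open>0\<close>, where row \<open>1\<close> is paired with a
  zero row.\<close>

definition grid_arcs :: "nat \<Rightarrow> (nat \<times> 't option + nat \<times> 't) set" where
  "grid_arcs n = ({..<n} \<times> UNIV) <+> ({..n} \<times> UNIV)"

definition grid_source :: "nat \<times> 't option + nat \<times> 't \<Rightarrow> nat \<times> 't option" where
  "grid_source = case_sum (\<lambda>(i, c). (Suc i, c)) (\<lambda>(i, t). (i, Some t))"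

definition grid_target :: "nat \<times> 't option + nat \<times> 't \<Rightarrow> nat \<times> 't option" where
  "grid_target = case_sum (\<lambda>(i, c). (i, c)) (\<lambda>(i, t). (i, None))"

text \<open>\<open>s1\<close> and \<open>s2\<close> collect the entry arcs out of and into the node,
  \<open>s3\<close> and \<open>s4\<close> the slack arcs. The vanishing hypotheses absorb the index
  bounds, so one formula holds at every node.\<close>

lemma divergence_grid:
  fixes z :: "nat \<Rightarrow> 't::finite option \<Rightarrow> real"
  assumes z: "\<And>i c. i = 0 \<or> n < i \<Longrightarrow> z i c = 0" and u: "\<And>i t. n < i \<Longrightarrow> u i t = 0"
  shows "divergence grid_source grid_target (grid_arcs n) (grid_flow z u) (i, c) =
    z i c - z (Suc i) c + (case c of Some t \<Rightarrow> u i t | None \<Rightarrow> - (\<Sum>t\<in>UNIV. u i t))"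
proof -
  have s1: "(\<Sum>(j, b)\<in>{..<n} \<times> UNIV. z (Suc j) b * of_bool ((Suc j, b) = (i, c))) = z i c"
  proof (cases i)
    case 0
    then show ?thesis using z by simp
  next
    case (Suc k)
    have "(\<Sum>(j, b)\<in>{..<n} \<times> UNIV. z (Suc j) b * of_bool ((Suc j, b) = (i, c)))
      = (\<Sum>a\<in>{..<n} \<times> UNIV. if a = (k, c) then z i c else 0)"
      using Suc by (intro sum.cong) auto
    then show ?thesis using Suc z by (simp add: sum.delta)
  qed
  have "(\<Sum>(j, b)\<in>{..<n} \<times> UNIV. z (Suc j) b * of_bool ((j, b) = (i, c)))
      = (\<Sum>a\<in>{..<n} \<times> UNIV. if a = (i, c) then z (Suc i) c else 0)"
    by (intro sum.cong) auto
  then have s2: "(\<Sum>(j, b)\<in>{..<n} \<times> UNIV. z (Suc j) b * of_bool ((j, b) = (i, c))) = z (Suc i) c"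
    using z by (simp add: sum.delta)
  have s3: "(\<Sum>(j, t)\<in>{..n} \<times> UNIV. u j t * of_bool ((j, Some t) = (i, c)))
      = (case c of Some t \<Rightarrow> u i t | None \<Rightarrow> 0)"
  proof (cases c)
    case None
    then show ?thesis by (auto intro!: sum.neutral)
  next
    case (Some t)
    have "(\<Sum>(j, b)\<in>{..n} \<times> UNIV. u j b * of_bool ((j, Some b) = (i, c)))
      = (\<Sum>a\<in>{..n} \<times> UNIV. if a = (i, t) then u i t else 0)"
      using Some by (intro sum.cong) auto
    then show ?thesis using Some u by (simp add: sum.delta)
  qed
  have s4: "(\<Sum>(j, t)\<in>{..n} \<times> UNIV. u j t * of_bool ((j, None) = (i, c)))
      = (case c of Some t \<Rightarrow> 0 | None \<Rightarrow> \<Sum>t\<in>UNIV. u i t)"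
  proof (cases c)
    case None
    have "(\<Sum>(j, t)\<in>{..n} \<times> UNIV. u j t * of_bool ((j, None) = (i, c)))
      = (\<Sum>j\<le>n. \<Sum>t\<in>UNIV. u j t * of_bool (j = i))"
      unfolding sum.cartesian_product using None by (intro sum.cong) auto
    also have "\<dots> = (\<Sum>j\<le>n. if j = i then \<Sum>t\<in>UNIV. u i t else 0)"
      by (intro sum.cong) auto
    finally show ?thesis using None u by (simp add: sum.delta)
  next
    case (Some t)
    then show ?thesis by (auto intro!: sum.neutral)
  qed
  have "divergence grid_source grid_target (grid_arcs n) (grid_flow z u) (i, c) =
     (\<Sum>(j, b)\<in>{..<n} \<times> UNIV. z (Suc j) b * of_bool ((Suc j, b) = (i, c)))
     - (\<Sum>(j, b)\<in>{..<n} \<times> UNIV. z (Suc j) b * of_bool ((j, b) = (i, c)))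
     + (\<Sum>(j, t)\<in>{..n} \<times> UNIV. u j t * of_bool ((j, Some t) = (i, c)))
     - (\<Sum>(j, t)\<in>{..n} \<times> UNIV. u j t * of_bool ((j, None) = (i, c)))"
    unfolding divergence_def grid_arcs_def
    by (subst sum.Plus) (simp_all add: o_def grid_flow_def grid_source_def grid_target_def
      case_prod_unfold right_diff_distrib sum_subtractf del: of_bool_eq_0_iff prod.inject)
  then show ?thesis using s1 s2 s3 s4 by (cases c) simp_all
qed

section \<open>Perturbation of a fractional grid\<close>

text \<open>Tight constraints have integral values, so it is enough that the direction vanishes on
  every integral entry, row sum and sum of vertical neighbours.\<close>

lemma grid_perturbation:
  fixes x :: "nat \<Rightarrow> 't::finite \<Rightarrow> real"
  assumes x0: "\<And>i t. i = 0 \<or> n < i \<Longrightarrow> x i t = 0" and frac: "\<exists>i t. x i t \<notin> \<int>"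
  shows "\<exists>y :: nat \<Rightarrow> 't \<Rightarrow> real. (\<exists>i t. y i t \<noteq> 0) \<and> (\<forall>i t. x i t \<in> \<int> \<longrightarrow> y i t = 0)
    \<and> (\<forall>i. (\<Sum>t\<in>UNIV. x i t) \<in> \<int> \<longrightarrow> (\<Sum>t\<in>UNIV. y i t) = 0)
    \<and> (\<forall>i t. x i t + x (Suc i) t \<in> \<int> \<longrightarrow> y i t + y (Suc i) t = 0)"
proof -
  define \<sigma> :: "nat \<Rightarrow> real" where "\<sigma> i = (-1) ^ i" for i
  have \<sigma>: "\<sigma> i \<in> \<int>" "\<sigma> i \<noteq> 0" "\<sigma> i * \<sigma> i = 1" "\<sigma> (Suc i) = - \<sigma> i" for i
    by (auto simp: \<sigma>_def simp flip: power_mult_distrib)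
  have \<sigma>Ints: "\<sigma> i * a \<in> \<int> \<longleftrightarrow> a \<in> \<int>" for i a
    by (metis Ints_mult \<sigma>(1,3) mult.assoc mult_1)
  \<comment> \<open>Outside rows \<open>1\<close> to \<open>n\<close> the row slack is
    \<open>0\<close>, not the signed \<open>1\<close> of the formula, as
    \<open>divergence_grid\<close> requires; this changes it by an integer.\<close>
  define z where "z i c = (case c of Some t \<Rightarrow> \<sigma> i * x i t
      | None \<Rightarrow> if i = 0 \<or> n < i then 0 else \<sigma> i * (1 - (\<Sum>t\<in>UNIV. x i t)))" for i c
  define u where "u i t = (if n < i then 0 else \<sigma> i * (1 - x i t - x (Suc i) t))" for i t
  have z0: "z i c = 0" if "i = 0 \<or> n < i" for i c
    using that x0 by (auto simp: z_def split: option.split)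
  have u0: "u i t = 0" if "n < i" for i t using that by (simp add: u_def)
  have "divergence grid_source grid_target (grid_arcs n) (grid_flow z u) v \<in> \<int>" for v
  proof -
    obtain i c where v: "v = (i, c)" by fastforce
    have "z i c - z (Suc i) c + (case c of Some t \<Rightarrow> u i t | None \<Rightarrow> - (\<Sum>t\<in>UNIV. u i t)) \<in> \<int>"
    proof (cases c)
      case None
      \<comment> \<open>Up to integers, \<open>z i None\<close> is minus the signed row sum, so in
        the divergence these terms cancel against the sum of the \<open>u i t\<close>.\<close>
      have zN: "z i None + \<sigma> i * (\<Sum>t\<in>UNIV. x i t) \<in> \<int>" for i
        using x0 \<sigma>(1) by (auto simp: z_def algebra_simps)
      have "(\<Sum>t\<in>UNIV. u i t) + \<sigma> i * (\<Sum>t\<in>UNIV. x i t) + \<sigma> i * (\<Sum>t\<in>UNIV. x (Suc i) t)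
          = (\<Sum>t\<in>(UNIV::'t set). if n < i then 0 else \<sigma> i)"
        unfolding sum_distrib_left sum.distrib[symmetric] using x0
        by (intro sum.cong) (auto simp: u_def algebra_simps)
      moreover have "(\<Sum>t\<in>(UNIV::'t set). if n < i then 0 else \<sigma> i) \<in> \<int>"
        using \<sigma>(1) by (intro Ints_sum) auto
      ultimately have "(\<Sum>t\<in>UNIV. u i t) + \<sigma> i * (\<Sum>t\<in>UNIV. x i t) + \<sigma> i * (\<Sum>t\<in>UNIV. x (Suc i) t) \<in> \<int>"
        by simp
      from Ints_diff[OF Ints_diff[OF zN[of i] zN[of "Suc i"]] this] show ?thesis
        using None by (simp add: \<sigma>(4) algebra_simps)
    next
      case (Some t)
      have "z i c - z (Suc i) c + u i t = (if n < i then 0 else \<sigma> i)"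
        using Some x0 by (auto simp: z_def u_def \<sigma>(4) algebra_simps)
      then show ?thesis using Some \<sigma>(1) by auto
    qed
    then show ?thesis by (simp only: v divergence_grid[OF z0 u0])
  qed
  moreover have "\<exists>a\<in>grid_arcs n. grid_flow z u a \<notin> \<int>"
  proof -
    obtain i t where it: "x i t \<notin> \<int>" using frac by blast
    then have i: "0 < i" "i \<le> n" using x0[of i t] by (cases "i = 0 \<or> n < i"; simp)+
    have "grid_flow z u (Inl (i - 1, Some t)) \<notin> \<int>"
      using i it \<sigma>Ints by (simp add: grid_flow_def z_def)
    moreover have "Inl (i - 1, Some t) \<in> grid_arcs n"
      using i by (auto simp: grid_arcs_def)
    ultimately show ?thesis by blast
  qed
  moreover have "finite (grid_arcs n :: (nat \<times> 't option + nat \<times> 't) set)"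
    by (simp add: grid_arcs_def)
  ultimately obtain g where g: "\<exists>a\<in>grid_arcs n. g a \<noteq> 0"
    "\<And>a. a \<notin> grid_arcs n \<or> grid_flow z u a \<in> \<int> \<Longrightarrow> g a = 0"
    "\<And>v. divergence grid_source grid_target (grid_arcs n) g v = 0"
    using fractional_flow_has_circulation[of "grid_arcs n" "grid_flow z u" grid_source grid_target]
    by metis
  \<comment> \<open>Reads \<open>g\<close> back as a grid. Row \<open>0\<close> is a separate case
    because \<open>i - 1\<close> truncates to \<open>0\<close> there and would pick the arc of row
    \<open>1\<close>.\<close>
  define z' where "z' i c = (if i = 0 then 0 else g (Inl (i - 1, c)))" for i c
  define u' where "u' i t = g (Inr (i, t))" for i t
  have g_eq: "g = grid_flow z' u'"
    by (auto simp: fun_eq_iff grid_flow_def z'_def u'_def split: sum.split)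
  have z'0: "z' i c = 0" if "i = 0 \<or> n < i" for i c
    using that by (auto simp: z'_def grid_arcs_def intro!: g(2))
  have u'0: "u' i t = 0" if "n < i" for i t
    using that by (auto simp: u'_def grid_arcs_def intro!: g(2))
  have cons: "z' i c - z' (Suc i) c + (case c of Some t \<Rightarrow> u' i t | None \<Rightarrow> - (\<Sum>t\<in>UNIV. u' i t)) = 0"
    for i c using g(3)[of "(i, c)"] unfolding g_eq by (simp only: divergence_grid[OF z'0 u'0])
  have col: "u' i t = z' (Suc i) (Some t) - z' i (Some t)" for i t
    using cons[of i "Some t"] by simp
  \<comment> \<open>By \<open>col\<close>, conservation at \<open>(i, None)\<close> says that this
    sum agrees in rows \<open>i\<close> and \<open>i + 1\<close>, and it starts at \<open>0\<close>.
    So \<open>z' i None\<close> offsets the change of the row sum.\<close>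
  have row: "z' i None + (\<Sum>t\<in>UNIV. z' i (Some t)) = 0" for i
  proof (induction i)
    case 0
    show ?case by (simp add: z'0)
  next
    case (Suc i)
    then show ?case using cons[of i None] by (simp add: col sum_subtractf)
  qed
  have z'Z: "z' i c = 0" if "z i c \<in> \<int>" for i c
    using that g(2)[of "Inl (i - 1, c)"] by (auto simp: z'_def grid_flow_def)
  have u'Z: "u' i t = 0" if "u i t \<in> \<int>" for i t
    using that g(2)[of "Inr (i, t)"] by (auto simp: u'_def grid_flow_def)
  define y where "y i t = \<sigma> i * z' i (Some t)" for i t
  \<comment> \<open>The columns \<open>Some t\<close> determine column \<open>None\<close> by
    \<open>row\<close> and the slack arcs by \<open>col\<close>, so \<open>y = 0\<close> would force
    \<open>g = 0\<close>.\<close>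
  have "\<exists>i t. y i t \<noteq> 0"
  proof (rule ccontr)
    assume "\<not> ?thesis"
    then have z't: "z' i (Some t) = 0" for i t using \<sigma>(2) by (auto simp: y_def)
    then have "z' i None = 0" for i using row[of i] by simp
    with z't have "z' i c = 0" for i c by (cases c) auto
    then have "g a = 0" for a by (auto simp: g_eq grid_flow_def col split: sum.split)
    with g(1) show False by blast
  qed
  moreover have "y i t = 0" if "x i t \<in> \<int>" for i t
    using that z'Z[of i "Some t"] \<sigma>Ints by (simp add: y_def z_def)
  moreover have "(\<Sum>t\<in>UNIV. y i t) = 0" if "(\<Sum>t\<in>UNIV. x i t) \<in> \<int>" for i
  proof -
    have "z i None \<in> \<int>" using that \<sigma>Ints by (auto simp: z_def)
    then have "(\<Sum>t\<in>UNIV. z' i (Some t)) = 0" using z'Z row[of i] by simp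
    then show ?thesis by (simp add: y_def flip: sum_distrib_left)
  qed
  moreover have "y i t + y (Suc i) t = 0" if "x i t + x (Suc i) t \<in> \<int>" for i t
  proof -
    have "1 - x i t - x (Suc i) t \<in> \<int>"
      using Ints_diff[OF Ints_1 that] by (simp add: algebra_simps)
    then have "u i t \<in> \<int>" using \<sigma>Ints by (simp add: u_def)
    then show ?thesis using u'Z[of i t] col[of i t] by (simp add: y_def \<sigma>(4))
  qed
  ultimately show ?thesis by (intro exI[of _ y]) simp
qed

section \<open>Extreme points and tight constraints\<close>

text \<open>A small move along \<open>y\<close> or \<open>- y\<close> leaves tight constraints
  unchanged and keeps the finitely many slack ones valid, so \<open>x\<close> is the midpoint of a
  segment inside the region.\<close>

lemma not_extreme_point_if_tight_direction:
  fixes x y :: "'a::euclidean_space"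
  assumes A: "finite A" and y: "y \<noteq> 0"
    and tight: "\<And>a b. (a, b) \<in> A \<Longrightarrow> a \<bullet> x = b \<Longrightarrow> a \<bullet> y = 0"
  shows "\<not> x extreme_point_of {x. \<forall>(a, b)\<in>A. a \<bullet> x \<le> b}"
proof
  define P where "P = {x. \<forall>(a, b)\<in>A. a \<bullet> x \<le> b}"
  assume ext: "x extreme_point_of {x. \<forall>(a, b)\<in>A. a \<bullet> x \<le> b}"
  then have ext: "x extreme_point_of P" by (simp add: P_def)
  then have x: "x \<in> P" by (simp add: extreme_point_of_def)
  \<comment> \<open>The filter \<open>at 0\<close> is two-sided, so one radius will serve both
    \<open>r / 2\<close> and \<open>- r / 2\<close>.\<close>
  have "\<forall>\<^sub>F e in at (0::real). (case p of (a, b) \<Rightarrow> a \<bullet> (x + e *\<^sub>R y) \<le> b)" if "p \<in> A" for p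
  proof -
    obtain a b where p: "p = (a, b)" by fastforce
    show ?thesis
    proof (cases "a \<bullet> x = b")
      case True
      then show ?thesis using tight that by (simp add: p inner_add_right)
    next
      case False
      then have "a \<bullet> x < b" using x that p by (fastforce simp: P_def)
      moreover have "((\<lambda>e. a \<bullet> (x + e *\<^sub>R y)) \<longlongrightarrow> a \<bullet> (x + 0 *\<^sub>R y)) (at 0)"
        by (intro tendsto_intros)
      ultimately have "\<forall>\<^sub>F e in at 0. a \<bullet> (x + e *\<^sub>R y) < b"
        by (intro order_tendstoD(2)) auto
      then show ?thesis by (simp add: p) (auto elim: eventually_mono)
    qed
  qed
  then have "\<forall>\<^sub>F e in at 0. \<forall>p\<in>A. (case p of (a, b) \<Rightarrow> a \<bullet> (x + e *\<^sub>R y) \<le> b)"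
    using A by (intro eventually_ball_finite) auto
  then have "\<forall>\<^sub>F e in at 0. x + e *\<^sub>R y \<in> P" by (simp add: P_def)
  then obtain r where r: "0 < r" "\<And>e. e \<noteq> 0 \<Longrightarrow> dist e 0 < r \<Longrightarrow> x + e *\<^sub>R y \<in> P"
    by (auto simp: eventually_at)
  define a b where "a = x + (r / 2) *\<^sub>R y" and "b = x + (- r / 2) *\<^sub>R y"
  have "a \<in> P" "b \<in> P" unfolding a_def b_def using r(1) by (intro r(2); simp)+
  moreover have "a \<noteq> b"
  proof -
    have "a - b = (r / 2 - - r / 2) *\<^sub>R y"
      by (simp only: a_def b_def scaleR_left_diff_distrib add_diff_cancel_left)
    then show ?thesis using r(1) y by auto
  qed
  moreover have "midpoint a b = x" by (simp add: a_def b_def midpoint_def scaleR_add_right)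
      (simp flip: scaleR_add_left)
  ultimately show False
    using ext midpoint_in_open_segment[of a b] by (auto simp: extreme_point_of_def)
qed

lemma integral_polyhedronI:
  fixes A :: "((real ^ 'k) \<times> real) set"
  assumes "finite A"
    and "\<And>x. (\<And>a b. (a, b) \<in> A \<Longrightarrow> a \<bullet> x \<le> b) \<Longrightarrow> \<exists>k. x $ k \<notin> \<int> \<Longrightarrow>
      \<exists>y. y \<noteq> 0 \<and> (\<forall>(a, b)\<in>A. a \<bullet> x = b \<longrightarrow> a \<bullet> y = 0)"
  shows "integral_polyhedron {x. \<forall>(a, b)\<in>A. a \<bullet> x \<le> b}"
  unfolding integral_polyhedron_def
proof (intro conjI allI impI)
  have "{x. \<forall>(a, b)\<in>A. a \<bullet> x \<le> b} = \<Inter>((\<lambda>(a, b). {x. a \<bullet> x \<le> b}) ` A)" by auto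
  then show "polyhedron {x. \<forall>(a, b)\<in>A. a \<bullet> x \<le> b}"
    using assms(1) by (auto intro!: polyhedron_Inter polyhedron_halfspace_le)
next
  fix x k
  assume ext: "x extreme_point_of {x. \<forall>(a, b)\<in>A. a \<bullet> x \<le> b}"
  show "x $ k \<in> \<int>"
  proof (rule ccontr)
    assume "x $ k \<notin> \<int>"
    moreover have "a \<bullet> x \<le> b" if "(a, b) \<in> A" for a b
      using ext that by (auto simp: extreme_point_of_def)
    ultimately obtain y where "y \<noteq> 0" "\<forall>(a, b)\<in>A. a \<bullet> x = b \<longrightarrow> a \<bullet> y = 0"
      using assms(2)[of x] by blast
    then show False using not_extreme_point_if_tight_direction[of A y x] assms(1) ext by blast
  qed
qed

section \<open>From the grid to vectors indexed by edges\<close>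

definition indicator_vec :: "'k set \<Rightarrow> real ^ 'k::finite" where
  "indicator_vec F = (\<chi> k. of_bool (k \<in> F))"

lemma indicator_vec_inner: "indicator_vec F \<bullet> x = (\<Sum>k\<in>F. x $ k)"
  by (simp add: indicator_vec_def inner_vec_def)

definition column_edges :: "(nat \<Rightarrow> 's) \<Rightarrow> nat \<Rightarrow> ('s \<times> 't) set \<Rightarrow> nat \<Rightarrow> nat \<Rightarrow> 't \<Rightarrow> ('s \<times> 't) set" where
  "column_edges s n E d i t = {(s', t'). (s', t') \<in> E \<and> s' \<in> window s n d i \<and> t' = t}"

text \<open>As \<open>z\<close> vanishes off \<open>E\<close>, the edge set drops out and a full
  grid row remains.\<close>

lemma sum_incident_edges:
  fixes z :: "real ^ ('s::finite \<times> 't::finite)"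
  assumes "\<And>e. e \<notin> E \<Longrightarrow> z $ e = 0"
  shows "(\<Sum>e\<in>incident_edges E v. z $ e) = (\<Sum>t\<in>UNIV. z $ (v, t))"
proof -
  have "(\<Sum>e\<in>incident_edges E v. z $ e) = (\<Sum>e\<in>Pair v ` UNIV. z $ e)"
    using assms by (intro sum.mono_neutral_left) (auto simp: incident_edges_def)
  also have "\<dots> = (\<Sum>t\<in>UNIV. z $ (v, t))"
    by (subst sum.reindex) (auto simp: inj_on_def)
  finally show ?thesis .
qed

lemma sum_column_edges:
  fixes z :: "real ^ ('s::finite \<times> 't::finite)"
  assumes "\<And>e. e \<notin> E \<Longrightarrow> z $ e = 0" and "inj_on s {1..n}" and "i \<in> {1..n}"
  shows "(\<Sum>e\<in>column_edges s n E d i t. z $ e) = (\<Sum>j\<in>{i..min (i + d - 1) n}. z $ (s j, t))"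
proof -
  have "(\<Sum>e\<in>column_edges s n E d i t. z $ e)
      = (\<Sum>e\<in>(\<lambda>j. (s j, t)) ` {i..min (i + d - 1) n}. z $ e)"
    using assms by (intro sum.mono_neutral_left) (auto simp: column_edges_def window_def)
  also have "\<dots> = (\<Sum>j\<in>{i..min (i + d - 1) n}. z $ (s j, t))"
  proof -
    have "inj_on s {i..min (i + d - 1) n}" by (rule inj_on_subset[OF assms(2)]) (use assms(3) in auto)
    then have "inj_on (\<lambda>j. (s j, t)) {i..min (i + d - 1) n}" by (auto simp: inj_on_def)
    then show ?thesis by (simp add: sum.reindex)
  qed
  finally show ?thesis .
qed

text \<open>Numbering the nodes by \<open>s\<close> and padding with zero rows turns
  \<open>x\<close> into a grid; the direction found there is carried back along the inverse
  numbering.\<close>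

lemma edge_vector_perturbation:
  fixes x :: "real ^ ('s::finite \<times> 't::finite)"
  assumes E: "E \<subseteq> S \<times> T" and s: "bij_betw s {1..n} S" and d: "d \<in> {1, 2}"
    and supp: "\<And>e. e \<notin> E \<Longrightarrow> x $ e = 0" and frac: "\<exists>e. x $ e \<notin> \<int>"
  shows "\<exists>y :: real ^ ('s \<times> 't). y \<noteq> 0 \<and> (\<forall>e. x $ e \<in> \<int> \<longrightarrow> y $ e = 0)
    \<and> (\<forall>i\<in>{1..n}. (\<Sum>e\<in>incident_edges E (s i). x $ e) \<in> \<int> \<longrightarrow>
         (\<Sum>e\<in>incident_edges E (s i). y $ e) = 0)
    \<and> (\<forall>i\<in>{1..n}. \<forall>t. (\<Sum>e\<in>column_edges s n E d i t. x $ e) \<in> \<int> \<longrightarrow>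
         (\<Sum>e\<in>column_edges s n E d i t. y $ e) = 0)"
proof -
  have inj: "inj_on s {1..n}" and img: "s ` {1..n} = S" using s by (auto simp: bij_betw_def)
  define x' where "x' i t = (if i \<in> {1..n} then x $ (s i, t) else 0)" for i t
  have x'0: "x' i t = 0" if "i = 0 \<or> n < i" for i t using that by (auto simp: x'_def)
  have "\<exists>i t. x' i t \<notin> \<int>"
  proof -
    obtain v t where vt: "x $ (v, t) \<notin> \<int>" using frac by auto
    then have "v \<in> s ` {1..n}" using supp[of "(v, t)"] E img by (cases "(v, t) \<in> E") auto
    then show ?thesis using vt by (auto simp: x'_def)
  qed
  then obtain y' :: "nat \<Rightarrow> 't \<Rightarrow> real" where y': "\<exists>i t. y' i t \<noteq> 0" "\<And>i t. x' i t \<in> \<int> \<Longrightarrow> y' i t = 0"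
    "\<And>i. (\<Sum>t\<in>UNIV. x' i t) \<in> \<int> \<Longrightarrow> (\<Sum>t\<in>UNIV. y' i t) = 0"
    "\<And>i t. x' i t + x' (Suc i) t \<in> \<int> \<Longrightarrow> y' i t + y' (Suc i) t = 0"
    using grid_perturbation[of n x'] x'0 by blast
  define y :: "real ^ ('s \<times> 't)" where
    "y = (\<chi> e. if fst e \<in> S then y' (inv_into {1..n} s (fst e)) (snd e) else 0)"
  have y_s: "y $ (s i, t) = y' i t" if "i \<in> {1..n}" for i t
    using that img inj by (auto simp: y_def)
  have yZ: "y $ e = 0" if "x $ e \<in> \<int>" for e
  proof -
    obtain v t where e: "e = (v, t)" by fastforce
    show ?thesis
    proof (cases "v \<in> S")
      case True
      then obtain i where "i \<in> {1..n}" "v = s i" using img by blast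
      then show ?thesis using that y'(2)[of i t] y_s by (simp add: e x'_def)
    next
      case False
      then show ?thesis by (simp add: e y_def)
    qed
  qed
  then have ysupp: "y $ e = 0" if "e \<notin> E" for e using supp that by simp
  have "y \<noteq> 0"
  proof -
    obtain i t where "y' i t \<noteq> 0" using y'(1) by blast
    moreover from this have "i \<in> {1..n}" using y'(2)[of i t] by (cases "i \<in> {1..n}") (auto simp: x'_def)
    ultimately show ?thesis using y_s[of i t] by auto
  qed
  moreover have "(\<Sum>e\<in>incident_edges E (s i). y $ e) = 0"
    if "i \<in> {1..n}" "(\<Sum>e\<in>incident_edges E (s i). x $ e) \<in> \<int>" for i
    using that y'(3)[of i] sum_incident_edges[OF supp] sum_incident_edges[OF ysupp] y_s
    by (simp add: x'_def)
  moreover have "(\<Sum>e\<in>column_edges s n E d i t. y $ e) = 0"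
    if i: "i \<in> {1..n}" and Z: "(\<Sum>e\<in>column_edges s n E d i t. x $ e) \<in> \<int>" for i t
  proof (cases "d = 2 \<and> i < n")
    \<comment> \<open>A window has two rows exactly when \<open>d = 2\<close> and
      \<open>i < n\<close>; for \<open>d = 1\<close> or \<open>i = n\<close> it contains the single
      row \<open>i\<close>.\<close>
    case True
    then have "{i..min (i + d - 1) n} = {i, Suc i}" by auto
    then show ?thesis
      using y'(4)[of i t] Z i True
      by (simp add: sum_column_edges[OF supp inj] sum_column_edges[OF ysupp inj] x'_def y_s)
  next
    case False
    then have "{i..min (i + d - 1) n} = {i}" using d i by auto
    then show ?thesis
      using y'(2)[of i t] Z i
      by (simp add: sum_column_edges[OF supp inj] sum_column_edges[OF ysupp inj] x'_def y_s)
  qed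
  ultimately show ?thesis using yZ by blast
qed

section \<open>Both regions as systems of linear inequalities\<close>

theorem theorem4:
  fixes S :: "'s::finite set" and T :: "'t::finite set" and E :: "('s \<times> 't) set"
    and s :: "nat \<Rightarrow> 's" and n d :: nat
  assumes "E \<subseteq> S \<times> T"
    and "bij_betw s {1..n} S"
    and "d \<in> {1, 2}"
  shows "integral_polyhedron (LP1_region s n T E d) \<and> integral_polyhedron (LP2_region s n T E d)"
proof -
  define rows where "rows = (\<lambda>i. incident_edges E (s i)) ` {1..n}"
  define cols where "cols = (\<lambda>(i, t). column_edges s n E d i t) ` ({1..n} \<times> T)"
  \<comment> \<open>A pair \<open>(a, b)\<close> encodes \<open>a \<bullet> x \<le> b\<close>. Off
    \<open>E\<close>, the bounds from both sides force the coordinate to be \<open>0\<close>. The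
    reversed row bounds in \<open>A2\<close> turn the row constraints into equations.\<close>
  define A1 where "A1 = (\<lambda>F. (indicator_vec F, 1::real)) ` (rows \<union> cols)
    \<union> (\<lambda>e. (- indicator_vec {e}, 0)) ` UNIV \<union> (\<lambda>e. (indicator_vec {e}, 0)) ` (- E)"
  define A2 where "A2 = A1 \<union> (\<lambda>F. (- indicator_vec F, -1)) ` rows"
  have fin: "finite A1" "finite A2" by (simp_all add: A1_def A2_def rows_def cols_def)
  have in_A1: "(\<forall>(a, b)\<in>A1. a \<bullet> x \<le> b) \<longleftrightarrow> (\<forall>e. 0 \<le> x $ e) \<and> (\<forall>e. e \<notin> E \<longrightarrow> x $ e \<le> 0)
      \<and> (\<forall>F\<in>rows \<union> cols. (\<Sum>e\<in>F. x $ e) \<le> 1)" for x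
    by (auto simp: A1_def ball_Un indicator_vec_inner)
  have in_A2: "(\<forall>(a, b)\<in>A2. a \<bullet> x \<le> b) \<longleftrightarrow> (\<forall>(a, b)\<in>A1. a \<bullet> x \<le> b)
      \<and> (\<forall>F\<in>rows. 1 \<le> (\<Sum>e\<in>F. x $ e))" for x
    by (auto simp: A2_def ball_Un indicator_vec_inner)
  have nonneg: "x \<in> nonneg_vectors E \<longleftrightarrow> (\<forall>e. 0 \<le> x $ e) \<and> (\<forall>e. e \<notin> E \<longrightarrow> x $ e \<le> 0)" for x
    unfolding nonneg_vectors_def by (auto intro: antisym)
  have LP1: "LP1_region s n T E d = {x. \<forall>(a, b)\<in>A1. a \<bullet> x \<le> b}"
    unfolding LP1_region_def in_A1 nonneg rows_def cols_def column_edges_def by auto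
  have LP2: "LP2_region s n T E d = {x. \<forall>(a, b)\<in>A2. a \<bullet> x \<le> b}"
  proof -
    have eq1: "r = 1 \<longleftrightarrow> r \<le> 1 \<and> 1 \<le> r" for r :: real by auto
    show ?thesis
      unfolding LP2_region_def in_A2 in_A1 nonneg rows_def cols_def column_edges_def eq1 by auto
  qed
  \<comment> \<open>One direction serves both programs: \<open>A1\<close> is contained in
    \<open>A2\<close>, so points satisfying \<open>A2\<close> also satisfy \<open>A1\<close>, and a
    direction that fits \<open>A2\<close> also fits \<open>A1\<close>.\<close>
  have pert: "\<exists>y. y \<noteq> 0 \<and> (\<forall>(a, b)\<in>A2. a \<bullet> x = b \<longrightarrow> a \<bullet> y = 0)"
    if x: "\<And>a b. (a, b) \<in> A1 \<Longrightarrow> a \<bullet> x \<le> b" and frac: "\<exists>k. x $ k \<notin> \<int>" for x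
  proof -
    have "\<forall>(a, b)\<in>A1. a \<bullet> x \<le> b" using x by blast
    then have "x \<in> nonneg_vectors E" unfolding in_A1 nonneg by blast
    then have "x $ e = 0" if "e \<notin> E" for e
      using that by (cases e) (simp add: nonneg_vectors_def)
    then obtain y :: "real ^ ('s \<times> 't)" where y: "y \<noteq> 0" "\<And>e. x $ e \<in> \<int> \<Longrightarrow> y $ e = 0"
      "\<And>i. i \<in> {1..n} \<Longrightarrow> (\<Sum>e\<in>incident_edges E (s i). x $ e) \<in> \<int> \<Longrightarrow>
         (\<Sum>e\<in>incident_edges E (s i). y $ e) = 0"
      "\<And>i t. i \<in> {1..n} \<Longrightarrow> (\<Sum>e\<in>column_edges s n E d i t. x $ e) \<in> \<int> \<Longrightarrow>
         (\<Sum>e\<in>column_edges s n E d i t. y $ e) = 0"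
      using edge_vector_perturbation[OF assms _ frac] by blast
    \<comment> \<open>A tight row or column has the integral value \<open>1\<close>, so the
      perturbation leaves it unchanged.\<close>
    have "(\<Sum>e\<in>F. y $ e) = 0" if "F \<in> rows \<union> cols" "(\<Sum>e\<in>F. x $ e) = 1" for F
      using that y(3,4) by (auto simp: rows_def cols_def)
    then have "\<forall>(a, b)\<in>A2. a \<bullet> x = b \<longrightarrow> a \<bullet> y = 0"
      using y(2) by (auto simp: A2_def A1_def indicator_vec_inner)
    with y(1) show ?thesis by blast
  qed
  have "integral_polyhedron {x. \<forall>(a, b)\<in>A2. a \<bullet> x \<le> b}"
    by (rule integral_polyhedronI[OF fin(2)], rule pert) (auto simp: A2_def)
  moreover have "integral_polyhedron {x. \<forall>(a, b)\<in>A1. a \<bullet> x \<le> b}"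
  proof (rule integral_polyhedronI[OF fin(1)])
    fix x
    assume "\<And>a b. (a, b) \<in> A1 \<Longrightarrow> a \<bullet> x \<le> b" "\<exists>k. x $ k \<notin> \<int>"
    from pert[OF this] show "\<exists>y. y \<noteq> 0 \<and> (\<forall>(a, b)\<in>A1. a \<bullet> x = b \<longrightarrow> a \<bullet> y = 0)"
      unfolding A2_def by blast
  qed
  ultimately show ?thesis by (simp only: LP1 LP2)
qed

end
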